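(* If $n>1$ is an integer and $e\ge 0$ is an integer with $e\not\equiv 4\pmod{10}$, then $\mathcal{D}_{4^e}(n)$ is even.
   Context: For an integer $k\ge 1$ let $U_0(k)=0$, $U_1(k)=1$, $U_{n+2}(k)=(4k+2)U_{n+1}(k)-U_n(k)$ for $n\ge 0$. For fixed $k$ these integers are pairwise distinct. The discriminator $\mathcal{D}_k(n)$ ($n\ge 1$) is the smallest integer $m\ge 1$ such that $U_0(k),\ldots,U_{n-1}(k)$ are pairwise incongruent modulo $m$. The corollary concerns $k=4^e$. *)

theory Defs
  imports "HOL-Number_Theory.Cong"
begin

fun U :: "nat \<Rightarrow> nat \<Rightarrow> int" where
  "U k 0 = 0"
| "U k (Suc 0) = 1"
| "U k (Suc (Suc n)) = (4 * int k + 2) * U k (Suc n) - U k n"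

definition discriminates :: "nat \<Rightarrow> nat \<Rightarrow> nat \<Rightarrow> bool" where
  "discriminates k n m \<longleftrightarrow>
     (\<forall>i<n. \<forall>j<n. i \<noteq> j \<longrightarrow> \<not> [U k i = U k j] (mod int m))"

(* The bound m >= 1 matters: congruence modulo 0 is equality. *)
definition discriminator :: "nat \<Rightarrow> nat \<Rightarrow> nat" where
  "discriminator k n = (LEAST m. m \<ge> 1 \<and> discriminates k n m)"

lemma U_less_Suc: "0 \<le> U k n \<and> U k n < U k (Suc n)"
proof (induction n)
  case 0
  show ?case by simp
next
  case (Suc n)
  have "0 \<le> int k * U k (Suc n)"
    using Suc by simp
  moreover have "U k (Suc (Suc n)) = 4 * (int k * U k (Suc n)) + 2 * U k (Suc n) - U k n"
    by (simp add: algebra_simps)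
  ultimately show ?case
    using Suc by linarith
qed

lemma strict_mono_U: "strict_mono (U k)"
  using U_less_Suc by (simp add: strict_mono_Suc_iff)

(* A modulus as required exists for all k and n, so the LEAST above is never
   applied to an unsatisfiable predicate. *)
lemma discriminator_exists: "\<exists>m\<ge>1. discriminates k n m"
proof (intro exI conjI)
  let ?m = "nat (U k n + 1)"
  have nn: "0 \<le> U k i" for i
    using U_less_Suc by blast
  show "?m \<ge> 1"
    using nn[of n] by simp
  show "discriminates k n ?m"
    unfolding discriminates_def
  proof (intro allI impI)
    fix i j assume ij: "i < n" "j < n" "i \<noteq> j"
    have "U k i < int ?m" "U k j < int ?m"
      using ij strict_monoD[OF strict_mono_U, of _ n k] nn[of n] by fastforce+
    moreover have "U k i \<noteq> U k j"
      using ij strict_mono_U[of k] by (simp add: strict_mono_eq)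
    ultimately show "\<not> [U k i = U k j] (mod int ?m)"
      using nn by (simp add: cong_def)
  qed
qed

end

theory Submission
  imports Defs "HOL-Number_Theory.Number_Theory"
begin

text \<open>
  Let $k = s^2$ and $P = 4k + 2$. Then $U_n = (\<alpha>^n - \<alpha>^{-n}) / (\<alpha> - \<alpha>^{-1})$
  with $\<alpha> = \<beta>^2$, where $\<beta> = s + \sqrt{s^2 + 1}$ has norm $-1$. The claim proved below is
  that an odd modulus $m$ coprime to $s$ which separates the first $n > 1$ terms is never the smallest
  one (\<open>odd_modulus_not_minimal\<close>). For $s = 2^e$ every odd modulus is coprime to $s$, so the
  discriminator is even.

  Split $m = M r$, where $M$ collects the primes dividing $k + 1$. The even number $2^b M$ with
  $b \geq 1$ separates as many terms as its size (\<open>discriminates_tower\<close>), since at 2 and at the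
  primes of $M$ the numbers $U_d$ are no more divisible than $d$. Let $r > 1$. Replacing $r$ by the
  largest power of two below it leaves at least $M (r + 1)/2$ terms separated. So it suffices that $m$
  itself separates at most that many (\<open>discriminates_bound\<close>). If $r = 1$, the terms with indices
  $(m - 1)/2$ and $(m + 1)/2$ coincide modulo $m$, and a power of two below $m$ does as well as $m$.

  This bound comes from $U_i = U_j$ whenever $\<alpha>^{i-j} = 1$ or $\<alpha>^{i+j} = -1$. Modulo $M$ one
  has $\<alpha>^M = -1$. For an odd prime $p$ not dividing $k (k + 1)$, the Frobenius map on
  $\<beta>$ gives $\<alpha>^{(p-1)/2} = 1$ or $\<alpha>^{(p+1)/2} = -1$ modulo $p$, according to whether
  $k + 1$ is a square (\<open>prime_sign_shift\<close>), and similar statements hold for the powers of $p$.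
  The prime powers are then combined by prescribing $i - j$ for some and $i + j$ for others. The parity
  of $i - j$ and of $i + j$ must agree, which is the only obstruction. If all the exponents giving
  $-1$ are odd, their product is such an exponent for the product of the moduli
  (\<open>bound_odd_signs\<close>). Otherwise one prime power with an even exponent is treated through
  $i + j$, and all the rest through an even period (\<open>bound_even_sign\<close>).
\<close>

section \<open>Lucas sequences of norm one\<close>

fun lucas :: "int \<Rightarrow> nat \<Rightarrow> int" where
  "lucas P 0 = 0"
| "lucas P (Suc 0) = 1"
| "lucas P (Suc (Suc n)) = P * lucas P (Suc n) - lucas P n"

text \<open>For $P = \<alpha> + \<alpha>^{-1}$ the sequence \<^term>\<open>lucas P\<close> is
  $(\<alpha>^n - \<alpha>^{-n}) / (\<alpha> - \<alpha>^{-1})$, and \<open>lucasV P n\<close> is the trace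
  $\<alpha>^n + \<alpha>^{-n}$, written without a second recursion.\<close>
definition lucasV :: "int \<Rightarrow> nat \<Rightarrow> int" where
  "lucasV P n = 2 * lucas P (Suc n) - P * lucas P n"

lemma U_eq_lucas: "U k n = lucas (4 * int k + 2) n"
  by (induction k n rule: U.induct) auto

lemma lucas_add: "lucas P (Suc (a + b)) = lucas P (Suc a) * lucas P (Suc b) - lucas P a * lucas P b"
proof (induction a arbitrary: b)
  case 0
  show ?case by simp
next
  case (Suc a)
  show ?case using Suc[of "Suc b"] by (simp add: algebra_simps)
qed

text \<open>The norm equation $\<alpha>^n \<alpha>^{-n} = 1$. It shows that a modulus dividing
  \<open>lucas P n\<close> makes \<open>lucas P (Suc n)\<close> a square root of 1.\<close>
lemma lucas_norm: "(lucas P (Suc n))\<^sup>2 - P * lucas P (Suc n) * lucas P n + (lucas P n)\<^sup>2 = 1"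
proof (induction n)
  case (Suc n)
  have "(lucas P (Suc (Suc n)))\<^sup>2 - P * lucas P (Suc (Suc n)) * lucas P (Suc n) + (lucas P (Suc n))\<^sup>2
    = (lucas P (Suc n))\<^sup>2 - P * lucas P (Suc n) * lucas P n + (lucas P n)\<^sup>2"
    by (simp add: power2_eq_square algebra_simps)
  also note Suc
  finally show ?case .
qed simp

lemma lucas_double: "lucas P (2 * n) = lucas P n * lucasV P n"
proof (cases n)
  case (Suc a)
  have a: "lucas P a = P * lucas P n - lucas P (Suc n)"
    using Suc by simp
  have "2 * n = Suc (a + n)" using Suc by simp
  then have "lucas P (2 * n) = lucas P n * lucas P (Suc n) - lucas P a * lucas P n"
    using lucas_add[of P a n] Suc by (simp only:)
  also have "\<dots> = lucas P n * lucasV P n"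
    unfolding a lucasV_def by (simp only: algebra_simps)
  finally show ?thesis .
qed simp

lemma lucas_double_Suc: "lucas P (Suc (2 * n)) = (lucas P (Suc n))\<^sup>2 - (lucas P n)\<^sup>2"
  using lucas_add[of P n n] by (simp add: power2_eq_square mult_2)

lemma lucas_sum: "lucas P (a + 2 * n) + lucas P a = lucasV P n * lucas P (a + n)"
proof (induction a rule: induct_nat_012)
  case 0
  show ?case by (simp add: lucas_double)
next
  case 1
  have eq: "lucas P (Suc 0 + 2 * n) = (lucas P (Suc n))\<^sup>2 - (lucas P n)\<^sup>2"
    using lucas_double_Suc[of P n] by simp
  show ?case unfolding eq lucasV_def using lucas_norm[of P n]
    by (simp add: power2_eq_square algebra_simps)
next
  case (ge2 a)
  have "lucas P (Suc (Suc a) + 2 * n) + lucas P (Suc (Suc a))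
      = P * (lucas P (Suc a + 2 * n) + lucas P (Suc a)) - (lucas P (a + 2 * n) + lucas P a)"
    by (simp add: algebra_simps)
  also have "\<dots> = lucasV P n * (P * lucas P (Suc a + n) - lucas P (a + n))"
    unfolding ge2 by (simp add: algebra_simps)
  finally show ?case by simp
qed

text \<open>The factorisation of a difference of two terms whose indices have the same parity: a modulus
  identifies the two terms exactly when it divides the product on the right.\<close>
lemma lucas_diff: "lucas P (j + 2 * d) - lucas P j = lucas P d * lucasV P (j + d)"
proof (induction j rule: induct_nat_012)
  case 0
  show ?case by (simp add: lucas_double)
next
  case 1
  have eq: "lucas P (Suc 0 + 2 * d) = (lucas P (Suc d))\<^sup>2 - (lucas P d)\<^sup>2"
    using lucas_double_Suc[of P d] by simp
  show ?case unfolding eq lucasV_def using lucas_norm[of P d]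
    by (simp add: power2_eq_square algebra_simps)
next
  case (ge2 j)
  have V: "lucasV P (Suc (Suc j) + d) = P * lucasV P (Suc j + d) - lucasV P (j + d)"
    by (simp add: lucasV_def algebra_simps)
  have "lucas P (Suc (Suc j) + 2 * d) - lucas P (Suc (Suc j))
      = P * (lucas P (Suc j + 2 * d) - lucas P (Suc j)) - (lucas P (j + 2 * d) - lucas P j)"
    by (simp add: algebra_simps)
  also have "\<dots> = lucas P d * lucasV P (Suc (Suc j) + d)"
    unfolding ge2 V by (simp add: algebra_simps)
  finally show ?case .
qed

text \<open>The terms at the multiples of \<open>n\<close> form, up to the factor \<open>lucas P n\<close>, again such a
  sequence, because $\<alpha>^n$ has trace \<open>lucasV P n\<close>. With \<open>m\<close> a prime this is what all
  liftings from a prime to its powers rest on.\<close>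
lemma lucas_mult: "lucas P (n * m) = lucas P n * lucas (lucasV P n) m"
proof (induction m rule: induct_nat_012)
  case (ge2 m)
  have "lucas P (n * m + 2 * n) + lucas P (n * m) = lucasV P n * lucas P (n * m + n)"
    by (rule lucas_sum)
  moreover have "n * m + 2 * n = n * Suc (Suc m)" "n * m + n = n * Suc m"
    by simp_all
  ultimately have "lucas P (n * Suc (Suc m)) = lucasV P n * lucas P (n * Suc m) - lucas P (n * m)"
    by (simp only:)
  also have "\<dots> = lucas P n * lucas (lucasV P n) (Suc (Suc m))"
    unfolding ge2 by (simp add: algebra_simps)
  finally show ?case .
qed auto

lemma lucasV_square: "(lucasV P n)\<^sup>2 - 4 = (P\<^sup>2 - 4) * (lucas P n)\<^sup>2"
proof -
  have "(lucasV P n)\<^sup>2 - 4 * ((lucas P (Suc n))\<^sup>2 - P * lucas P (Suc n) * lucas P n + (lucas P n)\<^sup>2)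
      = (P\<^sup>2 - 4) * (lucas P n)\<^sup>2"
    by (simp add: lucasV_def power2_eq_square algebra_simps)
  then show ?thesis by (simp add: lucas_norm)
qed

text \<open>At parameter $2\<sigma>$ the characteristic polynomial has the double root $\<sigma>$, where the
  sequence is $\<sigma>^{n+1} n$.\<close>
lemma lucas_mod_linear:
  fixes \<sigma> t :: int
  assumes \<sigma>: "\<sigma> = 1 \<or> \<sigma> = -1"
  shows "[lucas (2 * \<sigma> + t) n = \<sigma> ^ Suc n * int n] (mod t)"
proof (induction n rule: induct_nat_012)
  case (ge2 n)
  have "[(2 * \<sigma> + t) * lucas (2 * \<sigma> + t) (Suc n) - lucas (2 * \<sigma> + t) n
     = (2 * \<sigma> + 0) * (\<sigma> ^ Suc (Suc n) * int (Suc n)) - \<sigma> ^ Suc n * int n] (mod t)"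
    by (intro cong_diff cong_mult cong_add cong_refl ge2) (simp add: cong_0_iff)
  then show ?case using \<sigma> by (auto simp: algebra_simps)
qed (use \<sigma> in auto)

text \<open>The next term of the expansion around the double root. The exact coefficient of $t$ is
  $\<sigma>^n \binom{n+1}{3}$; the factor 6 clears its denominator.\<close>
lemma lucas_mod_square:
  fixes \<sigma> t :: int
  assumes \<sigma>: "\<sigma> = 1 \<or> \<sigma> = -1"
  shows "[6 * lucas (2 * \<sigma> + t) n = \<sigma> ^ Suc n * (6 * int n + \<sigma> * t * (int n ^ 3 - int n))] (mod t\<^sup>2)"
proof (induction n rule: induct_nat_012)
  case (ge2 n)
  define P where "P = 2 * \<sigma> + t"
  define W where "W m = \<sigma> ^ Suc m * (6 * int m + \<sigma> * t * (int m ^ 3 - int m))" for m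
  have "6 * lucas P (Suc (Suc n)) = P * (6 * lucas P (Suc n)) - 6 * lucas P n"
    by (simp add: algebra_simps)
  also have "[\<dots> = P * W (Suc n) - W n] (mod t\<^sup>2)"
    unfolding P_def W_def by (intro cong_diff cong_mult cong_refl ge2)
  also have "P * W (Suc n) - W n
      = W (Suc (Suc n)) + t\<^sup>2 * (\<sigma> ^ Suc (Suc n) * \<sigma> * (int (Suc n) ^ 3 - int (Suc n)))"
    using \<sigma> unfolding P_def W_def
    by (auto simp: power2_eq_square power3_eq_cube algebra_simps)
  also have "[\<dots> = W (Suc (Suc n))] (mod t\<^sup>2)"
    by (simp add: cong_iff_dvd_diff)
  finally show ?case unfolding P_def W_def .
qed (use \<sigma> in \<open>auto simp: power2_eq_square\<close>)

section \<open>Periods and antiperiods modulo an integer\<close>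

text \<open>For \<open>\<sigma> = 1\<close> a period, for \<open>\<sigma> = -1\<close> an antiperiod; it says
  $\<alpha>^h \equiv \<sigma>$ modulo \<open>q\<close> in the ring $\<int>[\<alpha>]$.\<close>
definition sign_shift :: "int \<Rightarrow> int \<Rightarrow> nat \<Rightarrow> nat \<Rightarrow> bool" where
  "sign_shift P \<sigma> h q \<longleftrightarrow> (\<forall>n. [lucas P (n + h) = \<sigma> * lucas P n] (mod int q))"

lemma sign_shiftI:
  assumes "int q dvd lucas P h" "[lucas P (Suc h) = \<sigma>] (mod int q)"
  shows "sign_shift P \<sigma> h q"
  unfolding sign_shift_def
proof
  fix n
  show "[lucas P (n + h) = \<sigma> * lucas P n] (mod int q)"
  proof (cases n)
    case 0
    then show ?thesis using assms(1) by (simp add: cong_0_iff)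
  next
    case (Suc a)
    have "[lucas P (Suc a) * lucas P (Suc h) - lucas P a * lucas P h
        = lucas P (Suc a) * \<sigma> - lucas P a * 0] (mod int q)"
      using assms by (intro cong_diff cong_mult cong_refl) (auto simp: cong_0_iff)
    then show ?thesis using Suc lucas_add[of P a h] by (simp add: mult.commute)
  qed
qed

lemma sign_shiftD:
  assumes "sign_shift P \<sigma> h q"
  shows "int q dvd lucas P h" "[lucas P (Suc h) = \<sigma>] (mod int q)"
  using assms[unfolded sign_shift_def, rule_format, of 0] assms[unfolded sign_shift_def, rule_format, of 1]
  by (auto simp: cong_0_iff)

lemma sign_shift_mult:
  assumes "sign_shift P \<sigma> h q"
  shows "sign_shift P (\<sigma> ^ c) (h * c) q"
proof (induction c)
  case (Suc c)
  show ?case unfolding sign_shift_def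
  proof
    fix n
    have "[lucas P ((n + h * c) + h) = \<sigma> * lucas P (n + h * c)] (mod int q)"
      using assms unfolding sign_shift_def by blast
    also have "[\<sigma> * lucas P (n + h * c) = \<sigma> * (\<sigma> ^ c * lucas P n)] (mod int q)"
      using Suc unfolding sign_shift_def by (intro cong_mult cong_refl) blast
    finally show "[lucas P (n + h * Suc c) = \<sigma> ^ Suc c * lucas P n] (mod int q)"
      by (simp add: algebra_simps)
  qed
qed (simp add: sign_shift_def)

lemma period_dvd: "sign_shift P 1 h q \<Longrightarrow> h dvd h' \<Longrightarrow> sign_shift P 1 h' q"
  using sign_shift_mult[of P 1 h q] by (metis dvdE power_one)

lemma antiperiod_odd_mult: "sign_shift P (-1) h q \<Longrightarrow> odd c \<Longrightarrow> sign_shift P (-1) (h * c) q"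
  using sign_shift_mult[of P "-1" h q c] by simp

lemma antiperiod_imp_period: "sign_shift P (-1) h q \<Longrightarrow> sign_shift P 1 (2 * h) q"
  using sign_shift_mult[of P "-1" h q 2] by (simp add: mult.commute)

lemma sign_shift_coprime:
  assumes "sign_shift P \<sigma> h q" "sign_shift P \<sigma> h q'" "coprime q q'"
  shows "sign_shift P \<sigma> h (q * q')"
  using assms coprime_cong_mult[where m="int q" and n="int q'"] by (auto simp: sign_shift_def)

text \<open>The sequence is odd in \<open>n\<close>, so shifting by an antiperiod turns $-j$ into $h - j$ without a
  change of sign. Antiperiods thus produce collisions at a prescribed sum of the indices, whereas
  periods produce them at a prescribed difference.\<close>
lemma lucas_reflect:
  assumes "sign_shift P (-1) h q" "i + j = h"
  shows "[lucas P i = lucas P j] (mod int q)"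
proof -
  note D = sign_shiftD[OF assms(1)]
  have "j \<le> h \<Longrightarrow> [lucas P (h - j) = lucas P j] (mod int q)" for j
  proof (induction j rule: induct_nat_012)
    case 0
    show ?case using D by (simp add: cong_0_iff)
  next
    case 1
    then have "h = Suc (h - 1)" by simp
    then have "lucas P (h - 1) = P * lucas P h - lucas P (Suc h)"
      by (metis add_diff_cancel_left' diff_add_cancel lucas.simps(3) uminus_add_conv_diff minus_diff_eq)
    moreover have "[P * lucas P h - lucas P (Suc h) = P * 0 - (-1)] (mod int q)"
      using D by (intro cong_diff cong_mult cong_refl) (simp_all add: cong_0_iff)
    ultimately show ?case by simp
  next
    case (ge2 j)
    have "h - j = Suc (Suc (h - Suc (Suc j)))" "h - Suc j = Suc (h - Suc (Suc j))"
      using ge2.prems by simp_all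
    then have "lucas P (h - Suc (Suc j)) = P * lucas P (h - Suc j) - lucas P (h - j)"
      by simp
    also have "[\<dots> = P * lucas P (Suc j) - lucas P j] (mod int q)"
      using ge2 by (intro cong_diff cong_mult cong_refl) auto
    finally show ?case by simp
  qed
  then show ?thesis using assms(2) by (metis add_diff_cancel_right' le_add2)
qed

section \<open>Lifting from primes to prime powers\<close>

text \<open>Only one of the two square roots of 1 modulo an odd prime power reduces to $\<sigma>$.\<close>
lemma unit_square_lift:
  fixes x \<sigma> :: int
  assumes "prime p" "odd p" "\<sigma> = 1 \<or> \<sigma> = -1"
    "[x\<^sup>2 = 1] (mod p ^ c)" "[x = \<sigma>] (mod p)"
  shows "[x = \<sigma>] (mod p ^ c)"
proof -
  have "p ^ c dvd x\<^sup>2 - 1" using assms(4) by (simp add: cong_iff_dvd_diff)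
  also have "x\<^sup>2 - 1 = (x - \<sigma>) * (x + \<sigma>)" using assms(3) by (auto simp: power2_eq_square algebra_simps)
  finally have d: "p ^ c dvd (x - \<sigma>) * (x + \<sigma>)" .
  have "\<not> p dvd x + \<sigma>"
  proof
    assume "p dvd x + \<sigma>"
    moreover have "p dvd x - \<sigma>" using assms(5) by (simp add: cong_iff_dvd_diff)
    ultimately have "p dvd (x + \<sigma>) - (x - \<sigma>)" by (rule dvd_diff)
    then have "p dvd 2 * \<sigma>" by simp
    then have "p dvd 2" using assms(3) by auto
    then have "p \<le> 2" by (rule zdvd_imp_le) simp
    then have "p = 2" using assms(1) prime_ge_2_int by (meson antisym)
    then show False using assms(2) by simp
  qed
  then have "coprime (p ^ c) (x + \<sigma>)" using assms(1) by (simp add: prime_imp_coprime)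
  with d have "p ^ c dvd x - \<sigma>" by (simp add: coprime_dvd_mult_left_iff)
  then show ?thesis by (simp add: cong_iff_dvd_diff)
qed

text \<open>$\<alpha>^h \equiv \<sigma>$ modulo $p^{c+1}$ gives $\<alpha>^{hp} \equiv \<sigma>$ modulo
  $p^{c+2}$: one factor $p$ is gained by the factorisation of \<open>lucas P (h * p)\<close>, and the norm
  equation determines the following term up to sign.\<close>
lemma sign_shift_lift:
  assumes p: "prime p" "odd p" and \<sigma>: "\<sigma> = 1 \<or> \<sigma> = -1"
    and sh: "sign_shift P \<sigma> h (p ^ Suc c)"
  shows "sign_shift P \<sigma> (h * p) (p ^ Suc (Suc c))"
proof (rule sign_shiftI)
  have ip: "prime (int p)" using p by simp
  have pdvd: "int p dvd int (p ^ Suc c)" by simp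
  note D = sign_shiftD[OF sh]
  have "[lucasV P h = 2 * \<sigma> - P * 0] (mod int p)" unfolding lucasV_def
    using D cong_dvd_modulus[OF _ pdvd] dvd_trans[OF pdvd]
    by (intro cong_diff cong_mult cong_refl) (auto simp: cong_0_iff)
  then have t: "int p dvd lucasV P h - 2 * \<sigma>" by (simp add: cong_iff_dvd_diff)
  have "[lucas (2 * \<sigma> + (lucasV P h - 2 * \<sigma>)) p = \<sigma> ^ Suc p * int p] (mod int p)"
    using lucas_mod_linear[OF \<sigma>] cong_dvd_modulus[OF _ t] by blast
  then have "[lucas (lucasV P h) p = 0] (mod int p)"
    by (simp add: cong_def)
  then have "int p dvd lucas (lucasV P h) p" by (simp add: cong_0_iff)
  then have "int (p ^ Suc c) * int p dvd lucas P (h * p)"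
    unfolding lucas_mult by (rule mult_dvd_mono[OF D(1)])
  moreover have "int (p ^ Suc c) * int p = int (p ^ Suc (Suc c))" by simp
  ultimately show z: "int (p ^ Suc (Suc c)) dvd lucas P (h * p)" by (simp only:)
  have "(lucas P (Suc (h * p)))\<^sup>2 - 1 = lucas P (h * p) * (P * lucas P (Suc (h*p)) - lucas P (h * p))"
    using lucas_norm[of P "h * p"] by (simp add: power2_eq_square algebra_simps)
  then have sq: "[(lucas P (Suc (h * p)))\<^sup>2 = 1] (mod int p ^ Suc (Suc c))"
    using z by (simp add: cong_iff_dvd_diff)
  have "sign_shift P (\<sigma> ^ p) (h * p) (p ^ Suc c)" by (rule sign_shift_mult[OF sh])
  then have "sign_shift P \<sigma> (h * p) (p ^ Suc c)" using \<sigma> p by auto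
  then have "[lucas P (Suc (h * p)) = \<sigma>] (mod int p)"
    using sign_shiftD(2) cong_dvd_modulus[OF _ pdvd] by blast
  then show "[lucas P (Suc (h * p)) = \<sigma>] (mod int (p ^ Suc (Suc c)))"
    using unit_square_lift[OF ip _ \<sigma> sq] p by simp
qed

lemma sign_shift_lift_power:
  assumes "prime p" "odd p" "\<sigma> = 1 \<or> \<sigma> = -1" "sign_shift P \<sigma> h p"
  shows "sign_shift P \<sigma> (h * p ^ c) (p ^ Suc c)"
proof (induction c)
  case (Suc c)
  have "sign_shift P \<sigma> (h * p ^ c * p) (p ^ Suc (Suc c))"
    by (rule sign_shift_lift[OF assms(1-3) Suc])
  moreover have "h * p ^ c * p = h * p ^ Suc c" by simp
  ultimately show ?case by (simp only:)
qed (use assms in simp)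

lemma prime_power_induct [consumes 1, case_names one prime_power]:
  fixes n :: nat
  assumes "n > 0" "Q 1"
    and step: "\<And>p a s. prime p \<Longrightarrow> s > 0 \<Longrightarrow> coprime (p ^ Suc a) s \<Longrightarrow> Q s \<Longrightarrow> Q (p ^ Suc a * s)"
  shows "Q n"
  using assms(1)
proof (induction n rule: less_induct)
  case (less n)
  show ?case
  proof (cases "n = 1")
    case False
    then obtain p where p: "prime p" "p dvd n" using prime_factor_nat by blast
    obtain s where s: "n = p ^ multiplicity p n * s" "\<not> p dvd s"
      using less.prems p multiplicity_decompose'[of n p] by (metis not_prime_unit not_gr_zero)
    have "multiplicity p n > 0" using p less.prems by (simp add: prime_multiplicity_gt_zero_iff)
    then obtain a where a: "multiplicity p n = Suc a" using gr0_implies_Suc by blast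
    have "s > 0" using s less.prems by (metis mult_0_right not_gr_zero)
    moreover have "s < n"
    proof -
      have "p ^ Suc a > 1" using p(1) prime_gt_1_nat one_less_power by blast
      then have "1 * s < p ^ Suc a * s" using \<open>s > 0\<close> mult_less_mono1 by blast
      then show ?thesis using s a by simp
    qed
    moreover have "coprime (p ^ Suc a) s" using p s by (simp add: prime_imp_coprime)
    ultimately show ?thesis using step[OF p(1)] less.IH s a by metis
  qed (use assms in simp)
qed

section \<open>The prime factors of k + 1\<close>

lemma prime_ge_5_not_dvd:
  fixes p :: nat
  assumes "prime p" "p \<ge> 5"
  shows "\<not> int p dvd 4" "\<not> int p dvd 6"
proof -
  have "\<not> int p dvd 2" "\<not> int p dvd 3"
    using assms zdvd_imp_le[of "int p" 2] zdvd_imp_le[of "int p" 3] by auto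
  moreover have "(4::int) = 2 * 2" "(6::int) = 2 * 3" by simp_all
  moreover have "prime (int p)" using assms by simp
  ultimately show "\<not> int p dvd 4" "\<not> int p dvd 6"
    by (metis prime_dvd_mult_iff)+
qed

text \<open>For $p \geq 5$ every term after the first of the expansion of
  $6 U_p$ around the double root is divisible by $p^2$, and $6p$ is not.\<close>
lemma lucas_prime_index_not_dvd_square:
  assumes p: "prime p" "p \<ge> 5" and \<sigma>: "\<sigma> = 1 \<or> \<sigma> = -1"
    and Q: "[Q = 2 * \<sigma>] (mod int p)"
  shows "\<not> (int p)\<^sup>2 dvd lucas Q p"
proof
  assume dvd: "(int p)\<^sup>2 dvd lucas Q p"
  obtain u where u: "Q - 2 * \<sigma> = int p * u"
    using Q by (auto simp: cong_iff_dvd_diff)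
  have t: "(int p)\<^sup>2 dvd (Q - 2 * \<sigma>)\<^sup>2" unfolding u by (simp add: power_mult_distrib)
  have "[6 * lucas Q p = \<sigma> ^ Suc p * (6 * int p + \<sigma> * (int p * u) * (int p ^ 3 - int p))] (mod (int p)\<^sup>2)"
    using cong_dvd_modulus[OF lucas_mod_square[OF \<sigma>, of "Q - 2 * \<sigma>" p] t] unfolding u[symmetric] by simp
  moreover have "[6 * lucas Q p = 0] (mod (int p)\<^sup>2)"
    using dvd by (simp add: cong_0_iff)
  ultimately have "[\<sigma> ^ Suc p * (6 * int p + \<sigma> * (int p * u) * (int p ^ 3 - int p)) = 0] (mod (int p)\<^sup>2)"
    using cong_sym cong_trans by blast
  then have "(int p)\<^sup>2 dvd \<sigma> ^ Suc p * (6 * int p + \<sigma> * (int p * u) * (int p ^ 3 - int p))"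
    by (simp add: cong_0_iff)
  moreover have "\<sigma> ^ Suc p = 1 \<or> \<sigma> ^ Suc p = -1" 
    using \<sigma> by (metis power_one minus_one_power_iff)
  ultimately have "(int p)\<^sup>2 dvd 6 * int p + \<sigma> * (int p * u) * (int p ^ 3 - int p)"
    by (elim disjE) (simp_all only: mult_minus1 mult_1 dvd_minus_iff)
  moreover have "6 * int p + \<sigma> * (int p * u) * (int p ^ 3 - int p) = 6 * int p + (int p)\<^sup>2 * (\<sigma> * u * ((int p)\<^sup>2 - 1))"
    by (simp add: power2_eq_square power3_eq_cube algebra_simps)
  ultimately have "(int p)\<^sup>2 dvd 6 * int p"
    by (metis dvd_add_left_iff dvd_triv_left)
  then have "int p dvd 6" using p by (simp add: power2_eq_square)
  then show False using prime_ge_5_not_dvd p by blast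
qed

text \<open>By \<open>lucas_mult\<close> a factor $p$ of the index brings at most one factor $p$ into the value,
  so the value is no more divisible by \<open>p\<close> than the index.\<close>
lemma prime_power_dvd_lucas_imp:
  assumes p: "prime p"
    and first: "\<And>n. int p dvd lucas P n \<Longrightarrow> p dvd n"
    and step: "\<And>n. \<not> (int p)\<^sup>2 dvd lucas (lucasV P n) p"
  shows "int (p ^ a) dvd lucas P n \<Longrightarrow> p ^ a dvd n"
proof (induction a arbitrary: n)
  case (Suc a)
  have ip: "prime (int p)" using p by simp
  have "int p dvd lucas P n" using Suc.prems by (metis dvd_mult_left of_nat_mult power_Suc)
  then obtain m where n: "n = m * p" using first by (metis dvdE mult.commute)
  define W where "W = lucas (lucasV P m) p"
  have d: "int p ^ Suc a dvd lucas P m * W"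
    using Suc.prems unfolding n lucas_mult W_def by simp
  have "int p ^ a dvd lucas P m"
  proof (cases "int p dvd W")
    case False
    then have "coprime (int p ^ Suc a) W" using ip by (simp add: prime_imp_coprime)
    with d have "int p ^ Suc a dvd lucas P m" by (simp add: coprime_dvd_mult_left_iff)
    then show ?thesis by (metis dvd_mult_right power_Suc)
  next
    case True
    then obtain w where w: "W = int p * w" by blast
    have "\<not> int p dvd w" using step[of m] w unfolding W_def[symmetric] by (auto simp: power2_eq_square)
    then have "coprime (int p ^ a) w" using ip by (simp add: prime_imp_coprime)
    moreover have "int p ^ a dvd lucas P m * w" using d p by (simp add: w)
    ultimately show ?thesis by (simp add: coprime_dvd_mult_left_iff)
  qed
  then have "p ^ a dvd m" using Suc.IH by simp
  then show ?case unfolding n by simp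
qed simp

lemma even_lucas_iff: "even P \<Longrightarrow> even (lucas P n) \<longleftrightarrow> even n"
  by (induction n rule: induct_nat_012) auto

lemma lucasV_eq_twice_odd:
  assumes "[P = 2] (mod 4)"
  obtains w where "lucasV P n = 2 * w" "odd w"
proof -
  obtain c where "P - 2 = 4 * c"
    using assms by (auto simp: cong_iff_dvd_diff)
  then have c: "P = 2 + 4 * c" by simp
  have "even P" using c by simp
  then have "odd (lucas P (Suc n) - (1 + 2 * c) * lucas P n)"
    by (simp add: even_lucas_iff del: lucas.simps)
  moreover have "lucasV P n = 2 * (lucas P (Suc n) - (1 + 2 * c) * lucas P n)"
    by (simp add: lucasV_def c algebra_simps del: lucas.simps)
  ultimately show ?thesis using that by blast
qed

text \<open>Since $V_n^2 - 4 = (P - 2)(P + 2) U_n^2$.\<close>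
lemma lucasV_prime_mod:
  assumes "prime p" "int p dvd P + 2"
  shows "\<exists>\<sigma>. (\<sigma> = 1 \<or> \<sigma> = -1) \<and> [lucasV P n = 2 * \<sigma>] (mod int p)"
proof -
  have "P\<^sup>2 - 4 = (P + 2) * (P - 2)" by (simp add: power2_eq_square algebra_simps)
  then have "int p dvd (lucasV P n)\<^sup>2 - 4" unfolding lucasV_square using assms by simp
  also have "(lucasV P n)\<^sup>2 - 4 = (lucasV P n - 2) * (lucasV P n + 2)"
    by (simp add: power2_eq_square algebra_simps)
  finally have "int p dvd lucasV P n - 2 \<or> int p dvd lucasV P n + 2"
    using assms prime_dvd_mult_iff[of "int p"] by simp
  then show ?thesis
  proof
    assume "int p dvd lucasV P n - 2"
    then show ?thesis by (intro exI[of _ 1]) (simp add: cong_iff_dvd_diff)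
  next
    assume "int p dvd lucasV P n + 2"
    then show ?thesis by (intro exI[of _ "-1"]) (simp add: cong_iff_dvd_diff)
  qed
qed

lemma prime_dvd_lucas_iff:
  assumes "prime p" "int p dvd P + 2"
  shows "int p dvd lucas P n \<longleftrightarrow> p dvd n"
proof -
  have "[lucas P n = (-1) ^ Suc n * int n] (mod int p)"
    using cong_dvd_modulus[OF lucas_mod_linear[of "-1" "P + 2" n] assms(2)] by simp
  then have "int p dvd lucas P n \<longleftrightarrow> int p dvd (-1) ^ Suc n * int n"
    by (rule cong_dvd_iff)
  also have "\<dots> \<longleftrightarrow> int p dvd int n" by (cases "even n") auto
  finally show ?thesis by simp
qed

text \<open>No prime factor of \<open>M\<close> divides the trace, which is $\pm 2$ modulo each of them.\<close>
lemma dvd_lucas_times_lucasV: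
  fixes M d m :: nat
  assumes "M > 0" "\<And>p. prime p \<Longrightarrow> p dvd M \<Longrightarrow> p \<ge> 5 \<and> int p dvd P + 2"
    "int M dvd lucas P d * lucasV P m"
  shows "M dvd d"
  using assms
proof (induction M rule: prime_power_induct)
  case (prime_power p a s)
  have "p dvd p ^ Suc a * s" by simp
  then have p: "prime p" "p \<ge> 5" "int p dvd P + 2" using prime_power by blast+
  have "p ^ Suc a dvd d"
  proof (rule prime_power_dvd_lucas_imp[OF p(1)])
    show "int p dvd lucas P n \<Longrightarrow> p dvd n" for n
      using prime_dvd_lucas_iff p by blast
    show "\<not> (int p)\<^sup>2 dvd lucas (lucasV P n) p" for n
      using lucasV_prime_mod[OF p(1,3)] lucas_prime_index_not_dvd_square[OF p(1,2)] by blast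
    have "\<not> int p dvd lucasV P m"
    proof
      assume *: "int p dvd lucasV P m"
      obtain \<sigma> where \<sigma>: "\<sigma> = 1 \<or> \<sigma> = -1" "[lucasV P m = 2 * \<sigma>] (mod int p)"
        using lucasV_prime_mod[OF p(1,3)] by blast
      then have "int p dvd 2 * \<sigma>" using * cong_dvd_iff by blast
      then have "int p dvd 2" using \<sigma> by auto
      then have "int p dvd 2 * 2" by (rule dvd_mult)
      then show False using prime_ge_5_not_dvd p by simp
    qed
    then have "coprime (int p ^ Suc a) (lucasV P m)"
      using p by (simp add: prime_imp_coprime)
    moreover have "int p ^ Suc a dvd lucas P d * lucasV P m"
      using prime_power.prems(2) by (metis dvd_mult_left of_nat_mult of_nat_power)
    ultimately show "int (p ^ Suc a) dvd lucas P d" by (simp add: coprime_dvd_mult_left_iff)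
  qed
  moreover have "s dvd d"
  proof (rule prime_power.IH)
    show "prime q \<Longrightarrow> q dvd s \<Longrightarrow> q \<ge> 5 \<and> int q dvd P + 2" for q
      using prime_power.prems(1) by (meson dvd_mult)
    show "int s dvd lucas P d * lucasV P m"
      using prime_power.prems(2) by (metis dvd_mult_right of_nat_mult)
  qed
  ultimately show ?case using prime_power by (simp add: divides_mult)
qed simp

lemma two_power_dvd_lucas_imp:
  assumes "[P = 2] (mod 4)" "int (2 ^ a) dvd lucas P n"
  shows "2 ^ a dvd n"
proof (rule prime_power_dvd_lucas_imp[OF two_is_prime_nat _ _ assms(2)])
  have "[P = 0] (mod 2)"
    using cong_dvd_modulus[OF assms(1), of 2] by (simp add: cong_def)
  then have "even P" by (simp add: cong_0_iff)
  then show "int 2 dvd lucas P n \<Longrightarrow> 2 dvd n" for n by (simp add: even_lucas_iff)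
  show "\<not> (int 2)\<^sup>2 dvd lucas (lucasV P n) 2" for n
  proof -
    obtain w where w: "lucasV P n = 2 * w" "odd w"
      using lucasV_eq_twice_odd[OF assms(1)] by blast
    have "lucas (lucasV P n) 2 = 2 * w"
      unfolding w(1) by (simp add: numeral_2_eq_2)
    moreover have "\<not> 4 dvd 2 * w" using w(2) by presburger
    ultimately show ?thesis by simp
  qed
qed

lemma dvd_parameter:
  assumes "p dvd k + 1"
  shows "int p dvd (4 * int k + 2) + 2"
proof -
  have "int p dvd int (k + 1)" using assms by (simp only: int_dvd_int_iff)
  then have "int p dvd 4 * int (k + 1)" by (rule dvd_mult)
  then show ?thesis by (simp add: algebra_simps)
qed

text \<open>Two terms congruent modulo an even number have indices of the same parity, so their difference
  factors by \<open>lucas_diff\<close>. Of the prime factors of the modulus the trace contains a single 2 and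
  nothing else, and at these primes the other factor is no more divisible than its index. An even
  modulus is essential: for $M > 1$, indices of different parity collide early modulo \<open>M\<close>.\<close>
lemma discriminates_tower:
  assumes M: "odd M" "\<And>p. prime p \<Longrightarrow> p dvd M \<Longrightarrow> p \<ge> 5 \<and> p dvd k + 1"
  shows "discriminates k (2 ^ Suc b * M) (2 ^ Suc b * M)"
proof -
  define P where "P = 4 * int k + 2"
  have P4: "[P = 2] (mod 4)" by (simp add: P_def cong_def)
  have evP: "even P" by (simp add: P_def)
  have M': "p \<ge> 5 \<and> int p dvd P + 2" if p: "prime p" "p dvd M" for p
    using M(2)[OF p] dvd_parameter unfolding P_def by blast
  have "\<not> [lucas P i = lucas P j] (mod int (2 ^ Suc b * M))"
    if ij: "i < j" "j < 2 ^ Suc b * M" for i j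
  proof
    assume "[lucas P i = lucas P j] (mod int (2 ^ Suc b * M))"
    then have d: "int (2 ^ Suc b * M) dvd lucas P j - lucas P i"
      by (metis cong_iff_dvd_diff cong_sym)
    moreover have "2 dvd int (2 ^ Suc b * M)" by simp
    ultimately have "even (lucas P j - lucas P i)" by (rule dvd_trans[rotated])
    then have "even (j - i)" using ij evP by (simp add: even_lucas_iff)
    then obtain e where "j - i = 2 * e" by blast
    then have e: "j = i + 2 * e" "e > 0" using ij by auto
    have d': "int (2 ^ Suc b * M) dvd lucas P e * lucasV P (i + e)"
      using d unfolding e lucas_diff .
    have "int M dvd lucas P e * lucasV P (i + e)"
      using d' by (metis dvd_mult_right of_nat_mult)
    then have "M dvd e" using dvd_lucas_times_lucasV[of M] M' M(1) by (metis odd_pos)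
    moreover have "2 ^ b dvd e"
    proof -
      obtain w where w: "lucasV P (i + e) = 2 * w" "odd w"
        using lucasV_eq_twice_odd[OF P4] by blast
      have "2 * 2 ^ b dvd lucas P e * (2 * w)"
        using d' unfolding w by (metis dvd_mult_left of_nat_mult of_nat_numeral of_nat_power power_Suc)
      then have "2 ^ b dvd lucas P e * w" by simp
      moreover have "coprime (2 ^ b) w" using w by simp
      ultimately have "2 ^ b dvd lucas P e" by (simp add: coprime_dvd_mult_left_iff)
      then show ?thesis using two_power_dvd_lucas_imp[OF P4] by simp
    qed
    moreover have "coprime (2 ^ b) M" using M(1) by simp
    ultimately have "2 ^ b * M dvd e" by (simp add: divides_mult)
    then have "2 ^ b * M \<le> e" using e by (simp add: dvd_imp_le)
    then show False using ij e by simp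
  qed
  then show ?thesis unfolding discriminates_def U_eq_lucas P_def[symmetric]
    by (metis cong_sym nat_neq_iff)
qed

text \<open>Modulo an odd prime divisor of $P + 2$ the sequence is $(-1)^{n+1} n$, whose antiperiod is that prime.
  Antiperiods of coprime moduli combine since all of them are odd.\<close>
lemma antiperiod_self:
  fixes M :: nat
  assumes "M > 0" "odd M" "\<And>p. prime p \<Longrightarrow> p dvd M \<Longrightarrow> int p dvd P + 2"
  shows "sign_shift P (-1) M M"
  using assms
proof (induction M rule: prime_power_induct)
  case one
  show ?case by (simp add: sign_shift_def)
next
  case (prime_power p a s)
  have "p dvd p ^ Suc a * s" by simp
  then have p: "int p dvd P + 2" "odd p" using prime_power by auto
  have "sign_shift P (-1) p p"
  proof (rule sign_shiftI)
    show "int p dvd lucas P p" using prime_dvd_lucas_iff[OF prime_power.hyps(1) p(1)] by simp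
    have "[lucas P (Suc p) = (-1) ^ Suc (Suc p) * int (Suc p)] (mod int p)"
      using cong_dvd_modulus[OF lucas_mod_linear[of "-1" "P + 2" "Suc p"] p(1)]
      by (simp del: power_Suc lucas.simps of_nat_Suc)
    also have "(-1) ^ Suc (Suc p) * int (Suc p) = -1 - int p" using p(2) by simp
    also have "[-1 - int p = -1] (mod int p)" by (simp add: cong_iff_dvd_diff)
    finally show "[lucas P (Suc p) = -1] (mod int p)" .
  qed
  then have "sign_shift P (-1) (p ^ Suc a) (p ^ Suc a)"
    using sign_shift_lift_power[of p "-1" P p a] prime_power.hyps p by simp
  moreover have "odd s" "odd (p ^ Suc a)" using prime_power.prems p by auto
  moreover have "sign_shift P (-1) s s"
    using prime_power.IH prime_power.prems \<open>odd s\<close> by (meson dvd_mult)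
  ultimately have "sign_shift P (-1) (p ^ Suc a * s) (p ^ Suc a)" "sign_shift P (-1) (s * p ^ Suc a) s"
    by (auto intro: antiperiod_odd_mult simp del: power_Suc)
  then show ?case using prime_power.hyps by (intro sign_shift_coprime) (simp_all add: mult.commute)
qed

section \<open>Half exponents at the primes not dividing k (k + 1)\<close>

text \<open>The coefficients of $(s + \sqrt D)^n = x_n + y_n \sqrt D$.\<close>
primrec quad_pow :: "int \<Rightarrow> int \<Rightarrow> nat \<Rightarrow> int \<times> int" where
  "quad_pow s D 0 = (1, 0)"
| "quad_pow s D (Suc n) = (s * fst (quad_pow s D n) + D * snd (quad_pow s D n), fst (quad_pow s D n) + s * snd (quad_pow s D n))"

text \<open>For $D = s^2 + 1$ the square of $s + \sqrt D$ is the number $\<alpha>$ with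
  $\<alpha> + \<alpha>^{-1} = 4 s^2 + 2$, so the even powers contain the sequence.\<close>
lemma quad_pow_even:
  "quad_pow s (s\<^sup>2 + 1) (2 * n) =
    (lucas (4 * s\<^sup>2 + 2) (Suc n) - (2 * s\<^sup>2 + 1) * lucas (4 * s\<^sup>2 + 2) n, 2 * s * lucas (4 * s\<^sup>2 + 2) n)"
proof (induction n)
  case (Suc n)
  have "2 * Suc n = Suc (Suc (2 * n))" by simp
  then show ?case by (simp only: quad_pow.simps Suc) (simp add: power2_eq_square algebra_simps)
qed simp

lemma sum_pascal:
  fixes g :: "nat \<Rightarrow> int"
  shows "(\<Sum>i\<le>Suc n. int (Suc n choose i) * g i)
    = (\<Sum>i\<le>n. int (n choose i) * g i) + (\<Sum>i\<le>n. int (n choose i) * g (Suc i))"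
proof -
  have "(\<Sum>i\<le>n. int (n choose i) * g i) = (\<Sum>i\<le>Suc n. int (n choose i) * g i)"
    by simp
  also have "\<dots> = g 0 + (\<Sum>i\<le>n. int (n choose Suc i) * g (Suc i))"
    by (simp only: sum.atMost_Suc_shift) simp
  finally have "(\<Sum>i\<le>n. int (n choose i) * g i) = g 0 + (\<Sum>i\<le>n. int (n choose Suc i) * g (Suc i))" .
  moreover have "(\<Sum>i\<le>Suc n. int (Suc n choose i) * g i)
      = g 0 + (\<Sum>i\<le>n. int (n choose i) * g (Suc i) + int (n choose Suc i) * g (Suc i))"
    by (simp only: sum.atMost_Suc_shift) (simp add: algebra_simps)
  ultimately show ?thesis by (simp add: sum.distrib)
qed

text \<open>A sequence with $f(i+2) = D f(i)$ stands for $(\sqrt D)^i$: its initial values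
  \<open>(1, 0)\<close> and \<open>(0, 1)\<close> select the two coefficients of the binomial expansion.\<close>
lemma quad_pow_binomial:
  assumes f: "\<And>i. f (Suc (Suc i)) = D * f i"
  shows "(\<Sum>i\<le>n. int (n choose i) * (s ^ (n - i) * f (i + m)))
    = fst (quad_pow s D n) * f m + snd (quad_pow s D n) * f (Suc m)"
proof (induction n arbitrary: m)
  case (Suc n)
  have "(\<Sum>i\<le>Suc n. int (Suc n choose i) * (s ^ (Suc n - i) * f (i + m)))
    = (\<Sum>i\<le>n. int (n choose i) * (s ^ (Suc n - i) * f (i + m)))
      + (\<Sum>i\<le>n. int (n choose i) * (s ^ (Suc n - Suc i) * f (Suc i + m)))"
    by (rule sum_pascal)
  also have "(\<Sum>i\<le>n. int (n choose i) * (s ^ (Suc n - i) * f (i + m)))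
      = s * (\<Sum>i\<le>n. int (n choose i) * (s ^ (n - i) * f (i + m)))"
    unfolding sum_distrib_left by (rule sum.cong) (auto simp: Suc_diff_le)
  also have "(\<Sum>i\<le>n. int (n choose i) * (s ^ (Suc n - Suc i) * f (Suc i + m)))
      = (\<Sum>i\<le>n. int (n choose i) * (s ^ (n - i) * f (i + Suc m)))"
    by simp
  finally show ?case unfolding Suc by (simp add: f algebra_simps)
qed simp

lemma sum_binomial_prime_mod:
  fixes g :: "nat \<Rightarrow> int"
  assumes "prime p"
  shows "[(\<Sum>i\<le>p. int (p choose i) * g i) = g 0 + g p] (mod int p)"
proof -
  have "p > 0" using assms prime_gt_0_nat by blast
  have "{..p} = insert 0 (insert p {1..<p})" by auto
  then have "(\<Sum>i\<le>p. int (p choose i) * g i) = g 0 + (g p + (\<Sum>i\<in>{1..<p}. int (p choose i) * g i))"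
    using \<open>p > 0\<close> by simp
  moreover have "int p dvd (\<Sum>i\<in>{1..<p}. int (p choose i) * g i)"
  proof (rule dvd_sum)
    fix i assume "i \<in> {1..<p}"
    then have "p dvd (p choose i)" using assms by (intro dvd_choose_prime) auto
    then show "int p dvd int (p choose i) * g i" by simp
  qed
  ultimately show ?thesis by (simp add: cong_iff_dvd_diff)
qed

text \<open>The Frobenius map: $(s + \sqrt D)^p \equiv s^p + D^{(p-1)/2} \sqrt D$.\<close>
lemma quad_pow_prime:
  assumes p: "prime p" "odd p"
  shows "[fst (quad_pow s D p) = s ^ p] (mod int p)" "[snd (quad_pow s D p) = D ^ (p div 2)] (mod int p)"
proof -
  have p0: "p > 0" using p prime_gt_0_nat by blast
  \<comment> \<open>$(\sqrt D)^i = w(i) + v(i) \sqrt D$, with $w$ here and $v$ below.\<close>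
  define w where "w = (\<lambda>i. if even i then D ^ (i div 2) else 0)"
  have "(\<Sum>i\<le>p. int (p choose i) * (s ^ (p - i) * w (i + 0))) = fst (quad_pow s D p) * w 0 + snd (quad_pow s D p) * w (Suc 0)"
    by (rule quad_pow_binomial) (auto simp: w_def)
  then show "[fst (quad_pow s D p) = s ^ p] (mod int p)"
    using sum_binomial_prime_mod[OF p(1), of "\<lambda>i. s ^ (p - i) * w i"] p p0 by (simp add: w_def)
  define v where "v = (\<lambda>i. if odd i then D ^ (i div 2) else 0)"
  have "(\<Sum>i\<le>p. int (p choose i) * (s ^ (p - i) * v (i + 0))) = fst (quad_pow s D p) * v 0 + snd (quad_pow s D p) * v (Suc 0)"
    by (rule quad_pow_binomial) (auto simp: v_def)
  then show "[snd (quad_pow s D p) = D ^ (p div 2)] (mod int p)"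
    using sum_binomial_prime_mod[OF p(1), of "\<lambda>i. s ^ (p - i) * v i"] p p0 by (simp add: v_def)
qed

lemma half_power_mod_prime:
  fixes a p :: nat
  assumes p: "prime p" "odd p" "\<not> p dvd a"
  shows "[int a ^ (p div 2) = 1] (mod int p) \<or> [int a ^ (p div 2) = -1] (mod int p)"
proof -
  have "[int (a ^ (p - 1)) = int 1] (mod int p)"
    using fermat_theorem[OF p(1,3)] by (simp only: cong_int_iff)
  moreover have "p - 1 = (p div 2) * 2" using p(2) by presburger
  ultimately have "[(int a ^ (p div 2))\<^sup>2 = 1] (mod int p)"
    by (simp add: power_mult)
  then have "int p dvd (int a ^ (p div 2))\<^sup>2 - 1" by (simp add: cong_iff_dvd_diff)
  also have "(int a ^ (p div 2))\<^sup>2 - 1 = (int a ^ (p div 2) - 1) * (int a ^ (p div 2) + 1)"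
    by (simp add: power2_eq_square algebra_simps)
  finally show ?thesis
    using p(1) prime_dvd_mult_iff[of "int p"] by (simp add: cong_iff_dvd_diff)
qed

text \<open>Let $\<beta> = s + \sqrt D$ with $D = s^2 + 1$, an element of norm $-1$. If $D$ is a square
  modulo $p$, then $\<beta>^p \equiv \<beta>$; otherwise Frobenius conjugates, so
  $\<beta>^{p+1} \equiv -1$. As $\<alpha> = \<beta>^2$, the half exponents $(p-1)/2$ and $(p+1)/2$
  are a period and an antiperiod. That \<open>k\<close> is a square is what places $\<beta>$ in this ring and
  so halves the exponents.\<close>
lemma prime_sign_shift:
  fixes s p :: nat
  assumes p: "prime p" "odd p" and s: "\<not> p dvd s" "\<not> p dvd s\<^sup>2 + 1"
  defines "P \<equiv> 4 * (int s)\<^sup>2 + 2"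
  shows "sign_shift P (-1) (Suc (p div 2)) p \<or> sign_shift P 1 (p div 2) p"
proof -
  have ip: "prime (int p)" using p by simp
  define D where "D = (int s)\<^sup>2 + 1"
  define x where "x = fst (quad_pow (int s) D p)"
  define y where "y = snd (quad_pow (int s) D p)"
  have sign_shiftI': "sign_shift P \<sigma> h p"
    if X: "[fst (quad_pow (int s) D (2 * h)) = \<sigma>] (mod int p)"
      and Y: "[snd (quad_pow (int s) D (2 * h)) = 0] (mod int p)" for \<sigma> h
  proof (rule sign_shiftI)
    have "int p dvd 2 * int s * lucas P h"
      using Y unfolding D_def quad_pow_even P_def by (simp add: cong_0_iff)
    moreover have "\<not> int p dvd 2"
    proof
      assume "int p dvd 2"
      then have "int p dvd int 2" by simp
      then have "p dvd 2" by (simp only: int_dvd_int_iff)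
      then have "p = 2" using p(1) primes_dvd_imp_eq two_is_prime_nat by blast
      then show False using p(2) by simp
    qed
    moreover have "\<not> int p dvd int s" using s by simp
    ultimately show z: "int p dvd lucas P h" using ip by (simp add: prime_dvd_mult_iff)
    have "[(lucas P (Suc h) - (2 * (int s)\<^sup>2 + 1) * lucas P h) + (2 * (int s)\<^sup>2 + 1) * lucas P h
        = \<sigma> + (2 * (int s)\<^sup>2 + 1) * 0] (mod int p)"
      using X z unfolding D_def quad_pow_even P_def
      by (intro cong_add cong_mult cong_refl) (simp_all add: cong_0_iff)
    then show "[lucas P (Suc h) = \<sigma>] (mod int p)" by (simp del: lucas.simps)
  qed
  have "[int (s ^ (p - 1)) = int 1] (mod int p)"
    using fermat_theorem[OF p(1) s(1)] by (simp only: cong_int_iff)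
  then have "[int s * int s ^ (p - 1) = int s * 1] (mod int p)"
    by (intro cong_mult cong_refl) simp
  moreover have "int s * int s ^ (p - 1) = int s ^ p"
    using prime_gt_0_nat[OF p(1)] by (metis power_eq_if neq0_conv)
  ultimately have x: "[x = int s] (mod int p)"
    using cong_trans[OF quad_pow_prime(1)[OF p]] unfolding x_def by simp
  have y0: "[y = D ^ (p div 2)] (mod int p)"
    unfolding y_def by (rule quad_pow_prime(2)[OF p])
  have D: "D = int (s\<^sup>2 + 1)" by (simp add: D_def)
  have DD: "D - int s * int s = 1" by (simp add: D_def power2_eq_square)
  from half_power_mod_prime[OF p s(2)] show ?thesis
  proof
    assume "[int (s\<^sup>2 + 1) ^ (p div 2) = 1] (mod int p)"
    then have y: "[y = 1] (mod int p)" using y0 cong_trans unfolding D by blast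
    have e: "p = Suc (2 * (p div 2))" using p(2) by presburger
    define u where "u = fst (quad_pow (int s) D (2 * (p div 2)))"
    define v where "v = snd (quad_pow (int s) D (2 * (p div 2)))"
    have xy: "x = int s * u + D * v" "y = u + int s * v"
      using e unfolding x_def y_def u_def v_def by (metis fst_conv snd_conv quad_pow.simps(2))+
    \<comment> \<open>$\<beta>$ has inverse $-s + \sqrt D$, so $\<beta>^{p-1}$ is recovered from $\<beta>^p$.\<close>
    have "[D * y - int s * x = D * 1 - int s * int s] (mod int p)"
      using x y by (intro cong_diff cong_mult cong_refl)
    moreover have "D * y - int s * x = (D - int s * int s) * u" unfolding xy by (simp add: algebra_simps)
    ultimately have "[u = 1] (mod int p)" using DD by simp
    moreover have "[x - int s * y = int s - int s * 1] (mod int p)"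
      using x y by (intro cong_diff cong_mult cong_refl)
    moreover have "x - int s * y = (D - int s * int s) * v" unfolding xy by (simp add: algebra_simps)
    ultimately show ?thesis using sign_shiftI'[of "p div 2" 1] DD unfolding u_def v_def by simp
  next
    assume "[int (s\<^sup>2 + 1) ^ (p div 2) = -1] (mod int p)"
    then have y: "[y = -1] (mod int p)" using y0 cong_trans unfolding D by blast
    have e: "2 * Suc (p div 2) = Suc p" using p(2) by presburger
    \<comment> \<open>The coefficients of $\<beta>^{p+1}$, from $\<beta>^p \equiv s - \sqrt D$.\<close>
    have "[int s * x + D * y = int s * int s + D * (-1)] (mod int p)"
      using x y by (intro cong_add cong_mult cong_refl)
    moreover have "int s * int s + D * (-1) = -1" using DD by simp
    moreover have "[x + int s * y = int s + int s * (-1)] (mod int p)"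
      using x y by (intro cong_add cong_mult cong_refl)
    ultimately show ?thesis using sign_shiftI'[of "Suc (p div 2)" "-1"] unfolding e x_def y_def by simp
  qed
qed

text \<open>The factor 3 against 2 is the worst case $(p+1)/2 \leq 2p/3$, attained at $p = 3$.\<close>
lemma prime_power_sign_shift:
  fixes s p :: nat
  assumes p: "prime p" "odd p" and s: "\<not> p dvd s" "\<not> p dvd s\<^sup>2 + 1"
  defines "P \<equiv> 4 * (int s)\<^sup>2 + 2"
  shows "(\<exists>h\<ge>1. sign_shift P (-1) h (p ^ Suc a) \<and> 3 * h \<le> 2 * p ^ Suc a)
       \<or> (\<exists>l\<ge>1. sign_shift P 1 l (p ^ Suc a) \<and> 2 * l < p ^ Suc a)"
proof -
  have "p \<noteq> 1" using p(1) by auto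
  then have p3: "p \<ge> 3" using p(2) by presburger
  have pa: "p ^ a > 0" using p3 by simp
  have pos: "c * p ^ a \<ge> 1" if "c \<ge> 1" for c
  proof -
    have "c * p ^ a \<noteq> 0" using that pa by (metis mult_is_0 not_one_le_zero less_not_refl)
    then show ?thesis by linarith
  qed
  from prime_sign_shift[OF p s] show ?thesis
  proof
    assume "sign_shift (4 * (int s)\<^sup>2 + 2) (-1) (Suc (p div 2)) p"
    then have "sign_shift P (-1) (Suc (p div 2) * p ^ a) (p ^ Suc a)"
      unfolding P_def using p by (intro sign_shift_lift_power) auto
    moreover have "3 * Suc (p div 2) \<le> 2 * p" using p3 p(2) by presburger
    then have "3 * Suc (p div 2) * p ^ a \<le> 2 * p * p ^ a" by (rule mult_le_mono1)
    then have "3 * (Suc (p div 2) * p ^ a) \<le> 2 * p ^ Suc a" by (simp only: power_Suc mult.assoc)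
    moreover have "Suc (p div 2) * p ^ a \<ge> 1" by (rule pos) simp
    ultimately show ?thesis by blast
  next
    assume "sign_shift (4 * (int s)\<^sup>2 + 2) 1 (p div 2) p"
    then have "sign_shift P 1 (p div 2 * p ^ a) (p ^ Suc a)"
      unfolding P_def using p by (intro sign_shift_lift_power) auto
    moreover have "2 * (p div 2) < p" using p(2) by presburger
    then have "2 * (p div 2) * p ^ a < p * p ^ a" using pa by (rule mult_less_mono1)
    then have "2 * (p div 2 * p ^ a) < p ^ Suc a" by (simp only: power_Suc mult.assoc)
    moreover have "p div 2 * p ^ a \<ge> 1" by (rule pos) (use p3 in simp)
    ultimately show ?thesis by blast
  qed
qed

section \<open>Splitting an odd modulus\<close>

lemma coprime_split:
  fixes n c :: nat
  assumes "n > 0"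
  shows "\<exists>M r. n = M * r \<and> coprime M r \<and> (\<forall>p. prime p \<longrightarrow> p dvd M \<longrightarrow> p dvd c) \<and> coprime r c"
  using assms
proof (induction n rule: prime_power_induct)
  case one
  show ?case by (intro exI[of _ 1]) auto
next
  case (prime_power p a s)
  then obtain M r where Mr: "s = M * r" "coprime M r" "\<forall>p. prime p \<longrightarrow> p dvd M \<longrightarrow> p dvd c" "coprime r c"
    by blast
  have cop: "coprime (p ^ Suc a) M" "coprime (p ^ Suc a) r"
    using prime_power.hyps unfolding Mr(1) by auto
  show ?case
  proof (cases "p dvd c")
    case True
    have "prime q \<Longrightarrow> q dvd p ^ Suc a * M \<Longrightarrow> q dvd c" for q
      using True Mr(3) prime_power.hyps(1)
      by (metis prime_dvd_mult_iff prime_dvd_power primes_dvd_imp_eq)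
    then show ?thesis using Mr cop
      by (intro exI[of _ "p ^ Suc a * M"] exI[of _ r]) (auto simp: mult.assoc simp del: power_Suc)
  next
    case False
    then have "coprime (p ^ Suc a) c" using prime_power.hyps(1) by (simp add: prime_imp_coprime)
    then show ?thesis using Mr cop
      by (intro exI[of _ M] exI[of _ "p ^ Suc a * r"]) (auto simp: ac_simps simp del: power_Suc)
  qed
qed

section \<open>Collisions and the resulting bounds\<close>

text \<open>Indices with difference a period modulo \<open>r\<close> and sum an odd multiple of an antiperiod modulo
  \<open>q\<close> collide modulo both.\<close>
lemma mixed_collision:
  assumes "discriminates k n (q * r)"
    and "sign_shift (4 * int k + 2) (-1) h q" "sign_shift (4 * int k + 2) 1 d r" "coprime q r"
    and "d \<ge> 1" "odd c" "h * c = d + 2 * j"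
  shows "n \<le> d + j"
proof (rule ccontr)
  assume "\<not> n \<le> d + j"
  then have "\<not> [U k (j + d) = U k j] (mod int (q * r))"
    using assms(1,5) unfolding discriminates_def by auto
  moreover have "[U k (j + d) = U k j] (mod int q)"
    unfolding U_eq_lucas using assms(7)
    by (intro lucas_reflect[OF antiperiod_odd_mult[OF assms(2,6)]]) simp
  moreover have "[U k (j + d) = U k j] (mod int r)"
    using assms(3) unfolding U_eq_lucas sign_shift_def by simp
  ultimately show False using coprime_cong_mult[where m="int q" and n="int r"] assms(4) by simp
qed

text \<open>Odd multiples of \<open>h\<close> are spaced by $2h$, so one of them is at least \<open>d\<close> and less than
  $d + 2h$, and it is \<open>h\<close> itself if \<open>h\<close> is not below \<open>d\<close>.\<close>
lemma mixed_collision_bounds: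
  assumes "discriminates k n (q * r)"
    and "sign_shift (4 * int k + 2) (-1) h q" "sign_shift (4 * int k + 2) 1 d r" "coprime q r"
    and "d \<ge> 1" "h \<ge> 1" "even (h + d)"
  shows "n < d + h" "d \<le> h \<Longrightarrow> 2 * n \<le> h + d"
proof -
  \<comment> \<open>The odd multiple $h (2t + 1)$ lies in the window from $d$ to $d + 2h - 1$.\<close>
  define t where "t = (d + h - 1) div (2 * h)"
  define S where "S = h * (2 * t + 1)"
  have "2 * h * t \<le> d + h - 1"
    unfolding t_def by (rule times_div_less_eq_dividend)
  moreover have "d + h - 1 < 2 * h + 2 * h * t"
    unfolding t_def using assms(6) by (intro dividend_less_times_div) simp
  ultimately have S: "d \<le> S" "S < d + 2 * h" using assms(5,6) by (simp_all add: S_def algebra_simps)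
  have "even (S - d)" using assms(7) S by (simp add: S_def)
  then obtain j where "S - d = 2 * j" by blast
  then have j: "S = d + 2 * j" using S by simp
  have "n \<le> d + j"
    by (rule mixed_collision[OF assms(1-5), of "2 * t + 1"]) (use j in \<open>simp_all add: S_def\<close>)
  then show "n < d + h" using S j by simp
  assume "d \<le> h"
  then have "t = 0" using assms(5,6) by (simp add: t_def)
  then have "S = h" by (simp add: S_def)
  then show "2 * n \<le> h + d" using \<open>n \<le> d + j\<close> j by simp
qed

text \<open>Doubling an antiperiod gives a period. Writing all periods as twice a number makes the common
  factor 2 count only once when coprime moduli are combined.\<close>
lemma even_period_exists:
  fixes r s :: nat
  assumes "r > 0" "\<And>p. prime p \<Longrightarrow> p dvd r \<Longrightarrow> odd p \<and> \<not> p dvd s \<and> \<not> p dvd s\<^sup>2 + 1"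
  defines "P \<equiv> 4 * (int s)\<^sup>2 + 2"
  shows "\<exists>g\<ge>1. sign_shift P 1 (2 * g) r \<and> (r = 1 \<and> g = 1 \<or> 3 * g \<le> 2 * r)"
  using assms(1,2)
proof (induction r rule: prime_power_induct)
  case one
  show ?case by (intro exI[of _ 1]) (simp add: sign_shift_def)
next
  case (prime_power p a t)
  define q where "q = p ^ Suc a"
  have "p dvd p ^ Suc a * t" by simp
  then have p: "odd p" "\<not> p dvd s" "\<not> p dvd s\<^sup>2 + 1"
    using prime_power.hyps(1) prime_power.prems by blast+
  obtain g1 where g1: "g1 \<ge> 1" "sign_shift P 1 (2 * g1) q" "3 * g1 \<le> 2 * q"
    using prime_power_sign_shift[OF prime_power.hyps(1) p, of a] unfolding P_def[symmetric] q_def[symmetric]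
  proof (elim disjE exE conjE)
    fix h assume h: "h \<ge> 1" "sign_shift P (-1) h q" "3 * h \<le> 2 * q"
    then show ?thesis using that[of h] antiperiod_imp_period by blast
  next
    fix l assume l: "l \<ge> 1" "sign_shift P 1 l q" "2 * l < q"
    then show ?thesis using that[of l] period_dvd[OF l(2), of "2 * l"] by simp
  qed
  have "\<And>p. prime p \<Longrightarrow> p dvd t \<Longrightarrow> odd p \<and> \<not> p dvd s \<and> \<not> p dvd s\<^sup>2 + 1"
    using prime_power.prems by (meson dvd_mult)
  then obtain g2 where g2: "g2 \<ge> 1" "sign_shift P 1 (2 * g2) t" "t = 1 \<and> g2 = 1 \<or> 3 * g2 \<le> 2 * t"
    using prime_power.IH by blast
  have "sign_shift P 1 (2 * (g1 * g2)) (q * t)"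
    using prime_power.hyps(3) unfolding q_def[symmetric]
    by (intro sign_shift_coprime period_dvd[OF g1(2)] period_dvd[OF g2(2)]) auto
  moreover have "g1 * g2 \<ge> 1" using g1(1) g2(1) by simp
  moreover have "3 * (g1 * g2) \<le> 2 * (q * t)"
    using g2(3)
  proof
    assume "3 * g2 \<le> 2 * t"
    then have "(3 * g1) * (3 * g2) \<le> (2 * q) * (2 * t)" by (rule mult_le_mono[OF g1(3)])
    then show ?thesis by linarith
  qed (use g1(3) in simp)
  ultimately show ?case unfolding q_def by blast
qed

text \<open>Odd antiperiods of coprime moduli multiply to an antiperiod, and periods multiply to a period.
  What resists such a combination is an even antiperiod; one prime power \<open>q\<close> having it is then
  singled out, and the remaining factor \<open>R\<close> is served by a period.\<close>
lemma sign_decomposition: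
  fixes r s :: nat
  assumes "r > 0" "\<And>p. prime p \<Longrightarrow> p dvd r \<Longrightarrow> odd p \<and> \<not> p dvd s \<and> \<not> p dvd s\<^sup>2 + 1"
  defines "P \<equiv> 4 * (int s)\<^sup>2 + 2"
  shows "(\<exists>r1 r2 h l. r = r1 * r2 \<and> coprime r1 r2 \<and> odd h \<and> sign_shift P (-1) h r1 \<and> h \<le> r1
            \<and> l \<ge> 1 \<and> sign_shift P 1 l r2 \<and> (r2 = 1 \<and> l = 1 \<or> 2 * l < r2))
       \<or> (\<exists>q R h. r = q * R \<and> coprime q R \<and> even h \<and> h \<ge> 1 \<and> sign_shift P (-1) h q \<and> 3 * h \<le> 2 * q)"
    (is "?X r \<or> ?E r")
  using assms(1,2)
proof (induction r rule: prime_power_induct)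
  case one
  have "?X 1" by (intro exI[of _ "1::nat"]) (simp add: sign_shift_def)
  then show ?case ..
next
  case (prime_power p a t)
  define q where "q = p ^ Suc a"
  have cop: "coprime q t" using prime_power.hyps(3) by (simp only: q_def)
  have "p dvd p ^ Suc a * t" by simp
  then have p: "odd p" "\<not> p dvd s" "\<not> p dvd s\<^sup>2 + 1"
    using prime_power.hyps(1) prime_power.prems by blast+
  have "\<And>p. prime p \<Longrightarrow> p dvd t \<Longrightarrow> odd p \<and> \<not> p dvd s \<and> \<not> p dvd s\<^sup>2 + 1"
    using prime_power.prems by (meson dvd_mult)
  then have IH: "?X t \<or> ?E t" by (rule prime_power.IH)
  have "?X (q * t) \<or> ?E (q * t)"
    using IH
  proof
    assume "?X t"
    then obtain r1 r2 h l where X: "t = r1 * r2" "coprime r1 r2" "odd h" "sign_shift P (-1) h r1" "h \<le> r1"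
        "l \<ge> 1" "sign_shift P 1 l r2" and b: "r2 = 1 \<and> l = 1 \<or> 2 * l < r2"
      by blast
    have cop': "coprime q r1" "coprime q r2" using cop X(1) by auto
    show ?thesis
      using prime_power_sign_shift[OF prime_power.hyps(1) p, of a] unfolding P_def[symmetric] q_def[symmetric]
    proof (elim disjE exE conjE)
      fix h' assume h': "h' \<ge> 1" "sign_shift P (-1) h' q" "3 * h' \<le> 2 * q"
      show ?thesis
      proof (cases "even h'")
        case True
        then have "?E (q * t)" using h' cop by blast
        then show ?thesis ..
      next
        case False
        have "sign_shift P (-1) (h' * h) (q * r1)"
          using antiperiod_odd_mult[OF h'(2) X(3)] antiperiod_odd_mult[OF X(4) False] cop'
          by (intro sign_shift_coprime) (simp_all add: mult.commute)
        moreover have "h' * h \<le> q * r1" using h'(3) X(5) by (intro mult_le_mono) auto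
        moreover have "q * t = (q * r1) * r2" "coprime (q * r1) r2" "odd (h' * h)"
          using X(1,2,3) cop' False by auto
        ultimately have "?X (q * t)" using X(6,7) b by blast
        then show ?thesis ..
      qed
    next
      fix l' assume l': "l' \<ge> 1" "sign_shift P 1 l' q" "2 * l' < q"
      have "sign_shift P 1 (l' * l) (q * r2)"
        using cop' by (intro sign_shift_coprime period_dvd[OF l'(2)] period_dvd[OF X(7)]) auto
      moreover have "2 * (l' * l) < q * r2"
        using b
      proof
        assume "2 * l < r2"
        then have "(2 * l') * l < q * r2" using l' X(6) by (intro mult_less_le_imp_less) auto
        then show ?thesis by simp
      qed (use l' in simp)
      moreover have "q * t = r1 * (q * r2)" "coprime r1 (q * r2)"
        using X(1,2) cop' by (auto simp: coprime_commute)
      moreover have "l' * l \<ge> 1" using l'(1) X(6) by simp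
      ultimately have "?X (q * t)" using X(3,4,5) by blast
      then show ?thesis ..
    qed
  next
    assume "?E t"
    then obtain q' R h where *: "t = q' * R" "coprime q' R" "even h" "h \<ge> 1"
        "sign_shift P (-1) h q'" "3 * h \<le> 2 * q'"
      by blast
    have "q * t = q' * (q * R)" "coprime q' (q * R)"
      using * cop by (auto simp: coprime_commute)
    then show ?thesis using * by blast
  qed
  then show ?case unfolding q_def .
qed

lemma discriminates_period_bound:
  assumes "discriminates k n m" "sign_shift (4 * int k + 2) 1 d m" "d \<ge> 1"
  shows "n \<le> d"
proof (rule ccontr)
  assume "\<not> n \<le> d"
  then have "d < n" "0 < n" "d \<noteq> 0" using assms(3) by simp_all
  then have "\<not> [U k d = U k 0] (mod int m)"
    using assms(1) unfolding discriminates_def by blast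
  moreover have "[U k d = U k 0] (mod int m)"
    using assms(2) unfolding U_eq_lucas sign_shift_def by (metis add_0 mult_1)
  ultimately show False by contradiction
qed

text \<open>If \<open>l\<close> is even, it makes up for the doubling of the antiperiod \<open>M * h\<close>, and
  \<open>M * h * l\<close> is a period of the whole modulus. If \<open>l\<close> is odd, it has the parity of
  \<open>M * h\<close>, and two indices at distance \<open>l\<close> with sum an odd multiple of \<open>M * h\<close>
  collide.\<close>
lemma bound_odd_signs:
  assumes "discriminates k n ((M * r1) * r2)" "odd M" "odd h" "coprime (M * r1) r2"
    and "sign_shift (4 * int k + 2) (-1) (M * h) (M * r1)" "sign_shift (4 * int k + 2) 1 l r2"
    and "h \<le> r1" "l \<ge> 1" "r2 = 1 \<and> l = 1 \<or> 2 * l < r2"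
  shows "2 * n \<le> M * (r1 * r2 + 1)"
proof -
  have pos: "M \<ge> 1" "h \<ge> 1"
    using odd_pos[OF assms(2)] odd_pos[OF assms(3)] by simp_all
  have pos': "M * h \<ge> 1" using mult_le_mono[OF pos] by simp
  have Mh: "M * h \<le> M * r1" using assms(7) by simp
  show ?thesis
  proof (cases "even l")
    case True
    then have l: "2 * l < r2" using assms(9) by auto
    obtain l' where l': "l = 2 * l'" using True by blast
    have "sign_shift (4 * int k + 2) 1 (M * h * l) ((M * r1) * r2)"
      using assms(4) l'
      by (intro sign_shift_coprime period_dvd[OF antiperiod_imp_period[OF assms(5)]] period_dvd[OF assms(6)]) auto
    then have "n \<le> M * h * l"
      by (rule discriminates_period_bound[OF assms(1)]) (use mult_le_mono[OF pos' assms(8)] in simp)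
    then have "2 * n \<le> (M * h) * (2 * l)" by simp
    also have "\<dots> \<le> (M * r1) * r2" by (rule mult_le_mono[OF Mh]) (use l in simp)
    finally show ?thesis by (simp add: distrib_left mult.assoc)
  next
    case False
    have "even (M * h + l)" using assms(2,3) False by simp
    note B = mixed_collision_bounds[OF assms(1,5,6,4,8) pos' this]
    show ?thesis
      using assms(9)
    proof
      assume *: "r2 = 1 \<and> l = 1"
      then have "2 * n \<le> M * h + 1" using B(2) pos' by simp
      also have "\<dots> \<le> M * r1 + M" by (rule add_mono[OF Mh pos(1)])
      finally show ?thesis using * by simp
    next
      assume l: "2 * l < r2"
      then have "r2 \<ge> 3" using assms(8) by linarith
      have "1 * (r2 - 2) \<le> (M * r1) * (r2 - 2)" using pos' Mh by (intro mult_le_mono1) linarith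
      moreover have "(M * r1) * (r2 - 2) + (M * r1) * 2 = (M * r1) * r2"
      proof -
        have "r2 - 2 + 2 = r2" using \<open>r2 \<ge> 3\<close> by simp
        then show ?thesis by (simp only: add_mult_distrib2[symmetric])
      qed
      moreover have "2 * n + 2 \<le> 2 * l + 2 * (M * r1)" using B(1) Mh by linarith
      ultimately have "2 * n \<le> (M * r1) * r2" using l by linarith
      then show ?thesis by (simp add: distrib_left mult.assoc)
    qed
  qed
qed

text \<open>The period \<open>2 * (M * g)\<close> of \<open>M * R\<close> is even, as is the antiperiod \<open>h\<close> of
  \<open>q\<close>, so indices with this difference and with sum an odd multiple of \<open>h\<close> exist. Their
  size is about \<open>2 * M * g + h\<close>, which is of order \<open>M * R\<close> and competes with half of
  \<open>q * M * R\<close>; only small \<open>q\<close> and \<open>R\<close> require care.\<close>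
lemma bound_even_sign:
  assumes disc: "discriminates k n (q * (M * R))" and "odd M" "odd R" "even h" "h \<ge> 1"
    and cop: "coprime q (M * R)"
    and h: "sign_shift (4 * int k + 2) (-1) h q" "3 * h \<le> 2 * q"
    and g: "sign_shift (4 * int k + 2) 1 (2 * (M * g)) (M * R)" "g \<ge> 1" "R = 1 \<and> g = 1 \<or> 3 * g \<le> 2 * R"
  shows "2 * n \<le> M * (q * R + 1)"
proof -
  have M: "M \<ge> 1" using assms(2) by (simp add: odd_pos Suc_leI)
  obtain t where t: "h = 2 * t" using assms(4) by blast
  have t1: "t \<ge> 1" and q: "q \<ge> 3 * t" using assms(5) h(2) t by auto
  have d1: "2 * (M * g) \<ge> 1" using mult_le_mono[OF M g(2)] by linarith
  have "even (h + 2 * (M * g))" using assms(4) by simp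
  note B = mixed_collision_bounds[OF disc h(1) g(1) cop d1 assms(5) this]
  show ?thesis
  proof (cases "R = 1")
    case True
    then have g1: "g = 1" using g(2,3) by auto
    show ?thesis
    proof (cases "t \<ge> M")
      case True
      then have "2 * n \<le> h + 2 * M" using B(2) t by (simp add: g1)
      moreover have "1 * (q - 1) \<le> M * (q - 1)" using M by (rule mult_le_mono1)
      then have "q + M \<le> M * q + 1" using q t1 by (simp add: diff_mult_distrib2)
      then have "2 * M + h \<le> M * q + M" using h(2) q t t1 by linarith
      ultimately show ?thesis using \<open>R = 1\<close> by simp
    next
      case Mt: False
      show ?thesis
      proof (cases "t = 1")
        case True
        \<comment> \<open>Here $h = 2$, and $2M$ is an odd multiple of it, so the indices $2M$ and $0$ collide. For
          $q = 3$ the resulting $n \leq 2M$ is exactly the bound claimed.\<close>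
        have "n \<le> 2 * M + 0"
          by (rule mixed_collision[OF disc h(1) g(1)[unfolded g1 mult_1_right] cop _ assms(2)])
            (use M t True in simp_all)
        moreover have "M * 3 \<le> M * q" using q True by simp
        ultimately have "2 * n \<le> M * q + M" by linarith
        then show ?thesis using \<open>R = 1\<close> by simp
      next
        case False
        \<comment> \<open>With $h = 2t$ one has $M > t$ and $q \geq 3t$. The product of these bounds outweighs the
          term $4t$ in $2n < 4M + 4t$.\<close>
        have "(t + 1) * (3 * (t - 1)) \<le> M * (q - 3)"
          using Mt q by (intro mult_le_mono) auto
        moreover have "(t + 1) * (3 * (t - 1)) + 3 = 3 * (t * t)"
          using t1 by (cases t) (auto simp: algebra_simps)
        moreover have "2 * t \<le> t * t" using False t1 by simp
        moreover have "M * (q - 3) + 3 * M = M * q" using q t1 by (simp add: diff_mult_distrib2)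
        moreover have "n < 2 * M + 2 * t" using B(1) t g1 by simp
        ultimately have "2 * n \<le> M * q + M" using False t1 by linarith
        then show ?thesis using \<open>R = 1\<close> by simp
      qed
    qed
  next
    case False
    then have R: "R \<ge> 3" using assms(3) by presburger
    have g3: "3 * g \<le> 2 * R" using g(3) False by blast
    have "M * (3 * g) \<le> M * (2 * R)" using g3 by simp
    then have Mg: "3 * (M * g) \<le> 2 * (M * R)" by simp
    have MR: "3 \<le> M * R" using mult_le_mono[OF M R] by simp
    have "q \<ge> 3" using q t1 by simp
    \<comment> \<open>A product whose expansion is the inequality between $8MR/3 + 4q/3$ and $qMR$ up to constants;
      it is tight for $q = R = 3$, $M = 1$.\<close>
    have "0 \<le> (3 * int q - 8) * (int (M * R) - 3)"
      using MR \<open>q \<ge> 3\<close> by (intro mult_nonneg_nonneg) linarith+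
    also have "\<dots> = (3 * (int q * int (M * R)) + 24) - (8 * int (M * R) + 9 * int q)"
      by (simp add: left_diff_distrib right_diff_distrib)
    finally have "int (8 * (M * R) + 9 * q) \<le> int (3 * (q * (M * R)) + 24)"
      by (simp only: of_nat_add of_nat_mult of_nat_numeral diff_ge_0_iff_ge)
    then have "8 * (M * R) + 9 * q \<le> 3 * (q * (M * R)) + 24"
      by (simp only: of_nat_le_iff)
    moreover have "2 * n + 2 \<le> 4 * (M * g) + 2 * h" using B(1) by linarith
    ultimately have "2 * n \<le> q * (M * R) + M" using Mg h(2) \<open>q \<ge> 3\<close> M by linarith
    then show ?thesis by (simp add: algebra_simps)
  qed
qed

text \<open>The value \<open>M * (r + 1) / 2\<close> is the one that a power of two can match: for odd
  $r \geq 3$ the largest power of two below \<open>r\<close> is at least $(r + 1)/2$.\<close>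
lemma discriminates_bound:
  fixes s M r n :: nat
  assumes disc: "discriminates (s\<^sup>2) n (M * r)" and odd: "odd M" "odd r" and cop: "coprime M r"
    and M: "\<And>p. prime p \<Longrightarrow> p dvd M \<Longrightarrow> p dvd s\<^sup>2 + 1"
    and r: "coprime r (s\<^sup>2 + 1)" "coprime r s"
  shows "2 * n \<le> M * (r + 1)"
proof -
  define P where "P = 4 * (int s)\<^sup>2 + 2"
  have P: "4 * int (s\<^sup>2) + 2 = P" by (simp add: P_def)
  have r': "odd p \<and> \<not> p dvd s \<and> \<not> p dvd s\<^sup>2 + 1" if "prime p" "p dvd r" for p
    using that odd(2) r by (meson coprime_common_divisor_nat dvd_trans not_prime_1 coprime_common_divisor not_prime_unit)
  have aM: "sign_shift P (-1) M M"
    unfolding P[symmetric] using odd(1) M dvd_parameter by (intro antiperiod_self odd_pos) blast+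
  have "r > 0" using odd(2) by (rule odd_pos)
  from sign_decomposition[OF this r', folded P_def]
  consider
    (odd_sign) r1 r2 h l where "r = r1 * r2" "coprime r1 r2" "odd h" "sign_shift P (-1) h r1" "h \<le> r1"
      "l \<ge> 1" "sign_shift P 1 l r2" "r2 = 1 \<and> l = 1 \<or> 2 * l < r2"
  | (even_sign) q R h where "r = q * R" "coprime q R" "even h" "h \<ge> 1" "sign_shift P (-1) h q"
      "3 * h \<le> 2 * q"
    by blast
  then show ?thesis
  proof cases
    case X: odd_sign
    have c: "coprime M r1" "coprime M r2" using cop X(1) by auto
    have "sign_shift P (-1) (M * h) (M * r1)"
      using antiperiod_odd_mult[OF aM X(3)] antiperiod_odd_mult[OF X(4) odd(1)] c
      by (intro sign_shift_coprime) (simp_all add: mult.commute)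
    moreover have "discriminates (s\<^sup>2) n ((M * r1) * r2)"
      using disc unfolding X(1) by (simp only: ac_simps)
    moreover have "coprime (M * r1) r2" using c X(2) by simp
    ultimately show ?thesis
      unfolding X(1) using bound_odd_signs[where k = "s\<^sup>2", OF _ odd(1) X(3) _ _ _ X(5,6,8), unfolded P] X(7) by blast
  next
    case E: even_sign
    have R: "odd R" using odd(2) E(1) by simp
    have "\<And>p. prime p \<Longrightarrow> p dvd R \<Longrightarrow> odd p \<and> \<not> p dvd s \<and> \<not> p dvd s\<^sup>2 + 1"
      using r' E(1) by (meson dvd_mult)
    then obtain g where g: "g \<ge> 1" "sign_shift P 1 (2 * g) R" "R = 1 \<and> g = 1 \<or> 3 * g \<le> 2 * R"
      using even_period_exists[of R s] R unfolding P_def[symmetric] by (auto simp: odd_pos)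
    have c: "coprime M q" "coprime M R" using cop E(1) by auto
    have "sign_shift P 1 (2 * (M * g)) (M * R)"
      using c by (intro sign_shift_coprime period_dvd[OF antiperiod_imp_period[OF aM]] period_dvd[OF g(2)]) auto
    moreover have "discriminates (s\<^sup>2) n (q * (M * R))"
      using disc unfolding E(1) by (simp only: ac_simps)
    moreover have "coprime q (M * R)" using c E(2) by (simp add: coprime_commute)
    ultimately show ?thesis
      unfolding E(1)
      using bound_even_sign[where k = "s\<^sup>2", OF _ odd(1) R E(3,4) _ _ E(6) _ g(1,3), unfolded P] E(5) by blast
  qed
qed

section \<open>Odd moduli are not minimal\<close>

text \<open>The odd cofactor \<open>t\<close> is replaced by the largest power of two below it.\<close>
lemma smaller_modulus_of_bound:
  assumes "odd N" "odd t" "t \<ge> 3" "2 * n \<le> N * (t + 1)"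
    and "\<And>p. prime p \<Longrightarrow> p dvd N \<Longrightarrow> p \<ge> 5 \<and> p dvd k + 1"
  shows "\<exists>m'\<ge>1. m' < N * t \<and> discriminates k n m'"
proof -
  have N: "N > 0" using assms(1) by (rule odd_pos)
  obtain c where c: "2 ^ c \<le> t" "t < 2 ^ (c + 1)"
    using ex_power_ivl1[of 2 t] assms(3) by auto
  have "c \<noteq> 0" using c assms(3) by (cases c) auto
  then obtain b where b: "c = Suc b" using not0_implies_Suc by blast
  have "2 ^ c \<noteq> t" using assms(2) b by auto
  then have "2 ^ Suc b * N < N * t" using c b N by simp
  moreover have "N * (t + 1) \<le> N * (2 * 2 ^ Suc b)"
    by (rule mult_le_mono2) (use c b in simp)
  with assms(4) have "2 * n \<le> N * (2 * 2 ^ Suc b)" by (rule order_trans)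
  then have "n \<le> 2 ^ Suc b * N" by (simp add: ac_simps)
  then have "discriminates k n (2 ^ Suc b * N)"
    using discriminates_tower[OF assms(1), of k b] assms(5) unfolding discriminates_def
    by (meson less_le_trans)
  moreover have "2 ^ Suc b * N \<ge> 1" using N by (simp add: Suc_leI)
  ultimately show ?thesis by blast
qed

text \<open>The primes dividing $s^2 + 1$ go into \<open>M\<close>. If nothing is left over, that is
  \<open>r = 1\<close>, the antiperiod \<open>M\<close> identifies the terms with indices $(M \pm 1)/2$, and \<open>M\<close>
  itself is replaced by a power of two.\<close>
lemma odd_modulus_not_minimal:
  fixes s m n :: nat
  assumes "odd m" "coprime m s" "n > 1" "discriminates (s\<^sup>2) n m"
  shows "\<exists>m'\<ge>1. m' < m \<and> discriminates (s\<^sup>2) n m'"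
proof -
  obtain M r where Mr: "m = M * r" "coprime M r" "\<And>p. prime p \<Longrightarrow> p dvd M \<Longrightarrow> p dvd s\<^sup>2 + 1"
    "coprime r (s\<^sup>2 + 1)"
    using coprime_split[OF odd_pos[OF assms(1)]] by blast
  have odd: "odd M" "odd r" using assms(1) Mr(1) by auto
  have bound: "2 * n \<le> M * (r + 1)"
    using assms Mr odd by (intro discriminates_bound[of s]) auto
  show ?thesis
  proof (cases "r = 1")
    case True
    then have m: "m = M" using Mr(1) by simp
    have "sign_shift (4 * int (s\<^sup>2) + 2) (-1) M M"
      using odd(1) Mr(3) dvd_parameter by (intro antiperiod_self odd_pos) blast+
    then have "2 * n \<le> 1 * (M * 1 + 1)"
      using assms(4) odd(1) m
      by (intro bound_odd_signs[where h = M and l = 1 and k = "s\<^sup>2"]) (simp_all add: sign_shift_def)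
    moreover from this have "M \<ge> 3" using assms(3) by simp
    ultimately show ?thesis
      using smaller_modulus_of_bound[of 1 M n "s\<^sup>2"] odd(1) m by simp
  next
    case False
    then have "r \<ge> 3" using odd(2) by presburger
    moreover have "p \<ge> 5 \<and> p dvd s\<^sup>2 + 1" if p: "prime p" "p dvd M" for p
    proof
      show "p dvd s\<^sup>2 + 1" using Mr(3) p by blast
      \<comment> \<open>$-1$ is not a square modulo 3.\<close>
      have "p \<noteq> 3"
      proof
        assume "p = 3"
        then have "(s\<^sup>2 + 1) mod 3 = 0" using \<open>p dvd s\<^sup>2 + 1\<close> by simp
        moreover have "(s\<^sup>2 + 1) mod 3 = ((s mod 3)\<^sup>2 + 1) mod 3"
          by (metis mod_add_left_eq power_mod)
        moreover have "s mod 3 = 0 \<or> s mod 3 = 1 \<or> s mod 3 = 2" by presburger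
        moreover have "((0::nat)\<^sup>2 + 1) mod 3 \<noteq> 0" "((1::nat)\<^sup>2 + 1) mod 3 \<noteq> 0"
          "((2::nat)\<^sup>2 + 1) mod 3 \<noteq> 0"
          by simp_all
        ultimately show False by metis
      qed
      moreover have "odd p" using p(2) odd(1) dvd_trans by blast
      moreover have "p \<noteq> 1" using p(1) by auto
      ultimately show "p \<ge> 5" by presburger
    qed
    ultimately show ?thesis
      using smaller_modulus_of_bound[OF odd _ bound] Mr(1) by simp
  qed
qed

theorem corollary2:
  fixes n e :: nat
  assumes "n > 1"
    and "\<not> [e = 4] (mod 10)"
  shows "even (discriminator (4 ^ e) n)"
proof (rule ccontr)
  let ?m = "discriminator (4 ^ e) n"
  assume "odd ?m"
  have four: "4 ^ e = (2 ^ e :: nat)\<^sup>2" by (simp add: power_even_eq power2_eq_square flip: power_mult_distrib)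
  have "discriminates (4 ^ e) n ?m"
    unfolding discriminator_def using discriminator_exists by (rule LeastI2_ex) blast
  moreover have "coprime ?m (2 ^ e)" using \<open>odd ?m\<close> by simp
  ultimately obtain m' where "m' \<ge> 1" "m' < ?m" "discriminates (4 ^ e) n m'"
    using odd_modulus_not_minimal[of ?m "2 ^ e" n] assms(1) \<open>odd ?m\<close> unfolding four by blast
  then show False unfolding discriminator_def using not_less_Least by blast
qed

end
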